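(* Let $G$ be a group, $H\leq G$ with $[G:H]=2$, and $J\leq H$. Let $L$ be a complete set of left coset representatives of $N_H(J)$ in $H$. For $l\in L$ write $J^l=lJl^{-1}$, and let $R(l)$ be a complete set of representatives of those right cosets of $J^l$ in $G$ that are contained in $G\setminus H$. For $l\in L$, $r\in R(l)$ let $P^l(r)=\{h(J^l\cup J^lr):h\in H\}$, a partition of $G$. Call $P^l(r)$ semiperfect if its stabilizer in $G$ (under left multiplication) is not all of $G$ (equivalently, equals $H$). Then: (i) If $N_G(J)=N_H(J)$, then the semiperfect colorings associated with the partitions $P^l(r)$ ($l\in L$, $r\in R(l)$) are pairwise inequivalent, i.e. no two distinct semiperfect partitions in this family are equivalent. (ii) If $N_G(J)\neq N_H(J)$, then the semiperfect partitions in this family fall into pairs of equivalent ones: each semiperfect $P^l(r)$ is equivalent to exactly one other partition $P^{l'}(r')$ of the family ($l'\in L$, $r'\in R(l')$), which is also semiperfect.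
   Context: $N_G(J)$ and $N_H(J)$ denote the normalizers of $J$ in $G$ and in $H$. $G$ acts on partitions of $G$ by left multiplication, $gP=\{gB:B\in P\}$; partitions $P,Q$ of $G$ (and their associated colorings) are equivalent if $Q=gP$ for some $g\in G$. A coloring associated with a partition is perfect if the stabilizer of the partition in $G$ is $G$, and semiperfect if the stabilizer has index $2$ in $G$. *)

theory Defs
  imports "HOL-Algebra.Algebra" "HOL-Algebra.Left_Coset" "HOL-Library.Disjoint_Sets"
begin

definition complete_reps :: "'a set set \<Rightarrow> 'a set \<Rightarrow> bool" where
  "complete_reps \<C> R \<longleftrightarrow> R \<subseteq> \<Union>\<C> \<and> (\<forall>C\<in>\<C>. \<exists>!x. x \<in> R \<inter> C)"

definition subgroup_index :: "('a, 'b) monoid_scheme \<Rightarrow> 'a set \<Rightarrow> nat" where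
  "subgroup_index G K = card (rcosets\<^bsub>G\<^esub> K)"

definition conj_subgroup :: "('a, 'b) monoid_scheme \<Rightarrow> 'a set \<Rightarrow> 'a \<Rightarrow> 'a set" where
  "conj_subgroup G J l = l <#\<^bsub>G\<^esub> J #>\<^bsub>G\<^esub> inv\<^bsub>G\<^esub> l"

definition translate :: "('a, 'b) monoid_scheme \<Rightarrow> 'a \<Rightarrow> 'a set set \<Rightarrow> 'a set set" where
  "translate G g P = (\<lambda>B. g <#\<^bsub>G\<^esub> B) ` P"

definition partition_stabilizer :: "('a, 'b) monoid_scheme \<Rightarrow> 'a set set \<Rightarrow> 'a set" where
  "partition_stabilizer G P = stabilizer G (translate G) P"

definition equivalent_partitions ::
    "('a, 'b) monoid_scheme \<Rightarrow> 'a set set \<Rightarrow> 'a set set \<Rightarrow> bool" where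
  "equivalent_partitions G P Q \<longleftrightarrow> (\<exists>g\<in>carrier G. Q = translate G g P)"

definition semiperfect :: "('a, 'b) monoid_scheme \<Rightarrow> 'a set set \<Rightarrow> bool" where
  "semiperfect G P \<longleftrightarrow> subgroup_index G (partition_stabilizer G P) = 2"

text \<open>
  With \<open>K\<close> a conjugate of \<open>J\<close>, \<open>coset_partition G H K r\<close> is
  the set of all \<open>h(K \<union> Kr)\<close> with \<open>h \<in> H\<close>.
\<close>

definition coset_partition ::
    "('a, 'b) monoid_scheme \<Rightarrow> 'a set \<Rightarrow> 'a set \<Rightarrow> 'a \<Rightarrow> 'a set set" where
  "coset_partition G H K r = {h <#\<^bsub>G\<^esub> (K \<union> (K #>\<^bsub>G\<^esub> r)) | h. h \<in> H}"

definition partition_family ::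
    "('a, 'b) monoid_scheme \<Rightarrow> 'a set \<Rightarrow> 'a set \<Rightarrow> 'a set \<Rightarrow> ('a \<Rightarrow> 'a set) \<Rightarrow> 'a set set set" where
  "partition_family G H J L R =
     {coset_partition G H (conj_subgroup G J l) r | l r. l \<in> L \<and> r \<in> R l}"

end

theory Submission
  imports Defs
begin

text \<open>
  Every element of \<open>H\<close> fixes \<open>P(K, r) = {h(K \<union> Kr) | h \<in> H}\<close>, and every element outside \<open>H\<close> moves it
  to the same partition, namely \<open>P(K', r\<inverse>)\<close> with \<open>K' = r\<inverse>Kr\<close>. So an orbit contains at most two
  partitions. Since \<open>P(K, r)\<close> determines both \<open>K\<close> and \<open>Kr\<close>, the second member of the orbit of
  \<open>P\<^sup>l(r)\<close> lies in the family iff \<open>r\<inverse>J\<^sup>lr\<close> is conjugate to \<open>J\<close> under \<open>H\<close>, that is, iff some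
  element outside \<open>H\<close> normalizes \<open>J\<close>.
\<close>

section \<open>Conjugates of a subgroup and its normalizer\<close>

lemma (in group) conj_subgroup_mult:
  assumes "J \<subseteq> carrier G" "a \<in> carrier G" "b \<in> carrier G"
  shows "conj_subgroup G (conj_subgroup G J b) a = conj_subgroup G J (a \<otimes> b)"
  using assms unfolding conj_subgroup_def
  by (simp add: coset_assoc lcos_m_assoc coset_mult_assoc l_coset_subset_G r_coset_subset_G inv_mult_group)

lemma (in group) conj_subgroup_one:
  "J \<subseteq> carrier G \<Longrightarrow> conj_subgroup G J \<one> = J"
  by (simp add: conj_subgroup_def lcos_mult_one)

lemma (in group) subgroup_conj_subgroup:
  "subgroup J G \<Longrightarrow> a \<in> carrier G \<Longrightarrow> subgroup (conj_subgroup G J a) G"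
  unfolding conj_subgroup_def by (rule subgroup_conjugation_is_surj2)

lemma (in group) normalizer_eq:
  assumes "J \<subseteq> carrier G"
  shows "normalizer G J = {g \<in> carrier G. conj_subgroup G J g = J}"
  using assms by (auto simp: normalizer_def stabilizer_def conj_subgroup_def)

text \<open>Inverses in \<open>H\<close> are those of \<open>G\<close>, so an element of
  \<open>H\<close> conjugates \<open>J\<close> in the same way in both groups. Hence
  \<open>N_G(J)\<close> and \<open>N_H(J)\<close> differ exactly when some element outside
  \<open>H\<close> normalizes \<open>J\<close>.\<close>

lemma (in group) normalizer_in_subgroup:
  assumes "subgroup H G" "J \<subseteq> H"
  shows "normalizer (G\<lparr>carrier := H\<rparr>) J = normalizer G J \<inter> H"
proof -
  interpret S: group "G\<lparr>carrier := H\<rparr>"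
    using assms subgroup_imp_group by blast
  have "H \<subseteq> carrier G" using assms subgroup.subset by blast
  then show ?thesis
    using S.normalizer_eq[of J] normalizer_eq[of J] assms
    by (auto simp: conj_subgroup_def m_inv_consistent)
qed

text \<open>Conjugating both sides by \<open>inv a\<close> turns the right side into the conjugate
  by \<open>inv a \<otimes> b\<close> and the left side into \<open>J\<close>. Conjugates of
  \<open>J\<close> thus correspond to left cosets of its normalizer.\<close>

lemma (in group) conj_subgroup_eq_iff:
  assumes "J \<subseteq> carrier G" "a \<in> carrier G" "b \<in> carrier G"
  shows "conj_subgroup G J a = conj_subgroup G J b \<longleftrightarrow> inv a \<otimes> b \<in> normalizer G J"
proof -
  have "conj_subgroup G J a = conj_subgroup G J b \<longleftrightarrow>
        conj_subgroup G (conj_subgroup G J b) (inv a) = J"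
  proof
    assume "conj_subgroup G J a = conj_subgroup G J b"
    then show "conj_subgroup G (conj_subgroup G J b) (inv a) = J"
      using assms by (metis conj_subgroup_mult conj_subgroup_one inv_closed l_inv)
  next
    assume *: "conj_subgroup G (conj_subgroup G J b) (inv a) = J"
    have "conj_subgroup G J a = conj_subgroup G J (a \<otimes> (inv a \<otimes> b))"
      using * assms by (metis conj_subgroup_mult inv_closed m_closed)
    also have "a \<otimes> (inv a \<otimes> b) = b"
      using assms by (simp add: m_assoc[symmetric])
    finally show "conj_subgroup G J a = conj_subgroup G J b" .
  qed
  then show ?thesis
    using assms by (simp add: normalizer_eq conj_subgroup_mult)
qed

lemma complete_reps_exists:
  assumes "complete_reps \<C> R" "C \<in> \<C>"
  obtains x where "x \<in> R" "x \<in> C"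
  using assms unfolding complete_reps_def by blast

section \<open>Subgroups of index two\<close>

locale index_two_subgroup = group G + subgroup H G for G (structure) and H +
  assumes index_two: "subgroup_index G H = 2"
begin

text \<open>\<open>H\<close> and \<open>H #> r\<close> are two distinct right cosets, hence all of
  them, and the cosets partition the group.\<close>

lemma r_coset_outside:
  assumes "r \<in> carrier G - H"
  shows "H #> r = carrier G - H"
proof -
  have sub: "{H, H #> r} \<subseteq> rcosets H"
    using assms rcosetsI[of H r] rcosetsI[of H \<one>] subset by simp
  have ne: "H \<noteq> H #> r"
    using assms rcos_self[of r H] subgroup_axioms by auto
  have "card (rcosets H) = 2"
    using index_two by (simp add: subgroup_index_def)
  \<comment> \<open>The set of cosets is finite because its \<open>card\<close> is nonzero; the
    group itself may be infinite.\<close>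
  then have "{H, H #> r} = rcosets H"
    using ne sub by (intro card_subset_eq card_ge_0_finite) simp_all
  moreover have "disjnt H (H #> r)"
    using rcos_disjoint[OF subgroup_axioms] sub ne by (auto simp: pairwise_def)
  moreover have "carrier G = H \<union> (H #> r)"
    using rcosets_part_G[OF subgroup_axioms] calculation(1) by auto
  ultimately show ?thesis by (auto simp: disjnt_def)
qed

text \<open>This is the homomorphism onto the group of order two with kernel \<open>H\<close>,
  written as a parity rule. It decides on which side of \<open>H\<close> a product lies.\<close>

lemma mult_mem_iff:
  assumes "a \<in> carrier G" "b \<in> carrier G"
  shows "a \<otimes> b \<in> H \<longleftrightarrow> (a \<in> H \<longleftrightarrow> b \<in> H)"
proof (cases "b \<in> H")
  case True
  have "a \<in> H" if "a \<otimes> b \<in> H"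
    using subgroup.m_closed[OF subgroup_axioms that m_inv_closed[OF True]] assms
    by (simp add: m_assoc)
  then show ?thesis using True by auto
next
  case False
  then have nb: "inv b \<notin> H"
    using assms by (metis inv_inv m_inv_closed)
  have "a \<in> H \<Longrightarrow> a \<otimes> b \<notin> H"
    using r_coset_outside[of b] False assms by (auto simp: r_coset_def)
  \<comment> \<open>With both factors outside \<open>H\<close>, the coset \<open>H #> inv b\<close>
    is the whole complement and so contains \<open>a\<close>; then
    \<open>a = h \<otimes> inv b\<close> gives \<open>a \<otimes> b = h\<close>.\<close>
  moreover have "a \<otimes> b \<in> H" if "a \<notin> H"
  proof -
    have "a \<in> H #> inv b"
      using r_coset_outside[of "inv b"] nb assms that by auto
    then obtain h where "h \<in> H" "a = h \<otimes> inv b" by (auto simp: r_coset_def)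
    then show ?thesis using assms by (simp add: m_assoc)
  qed
  ultimately show ?thesis using False by auto
qed

lemma inv_mem_iff: "a \<in> carrier G \<Longrightarrow> inv a \<in> H \<longleftrightarrow> a \<in> H"
  by (metis inv_inv m_inv_closed)

lemma mult_image:
  assumes "a \<in> carrier G"
  shows "(\<lambda>h. a \<otimes> h) ` H = (if a \<in> H then H else carrier G - H)"
    and "(\<lambda>h. h \<otimes> a) ` H = (if a \<in> H then H else carrier G - H)"
proof -
  have "x \<in> (\<lambda>h. a \<otimes> h) ` H" if "x \<in> carrier G" "x \<in> H \<longleftrightarrow> a \<in> H" for x
    using that assms by (intro image_eqI[of _ _ "inv a \<otimes> x"])
      (auto simp: mult_mem_iff inv_mem_iff m_assoc[symmetric])
  then show "(\<lambda>h. a \<otimes> h) ` H = (if a \<in> H then H else carrier G - H)"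
    using assms by (auto simp: mult_mem_iff)
  have "x \<in> (\<lambda>h. h \<otimes> a) ` H" if "x \<in> carrier G" "x \<in> H \<longleftrightarrow> a \<in> H" for x
    using that assms by (intro image_eqI[of _ _ "x \<otimes> inv a"])
      (auto simp: mult_mem_iff inv_mem_iff m_assoc)
  then show "(\<lambda>h. h \<otimes> a) ` H = (if a \<in> H then H else carrier G - H)"
    using assms by (auto simp: mult_mem_iff)
qed

section \<open>The partitions and their translates\<close>

lemma coset_partition_image:
  "coset_partition G H K r = (\<lambda>h. h <# (K \<union> (K #> r))) ` H"
  unfolding coset_partition_def by auto

text \<open>Translation by \<open>g\<close> replaces the index set \<open>H\<close> by
  \<open>gH\<close>, which is \<open>H\<close> or its complement. All elements outside
  \<open>H\<close> therefore act alike.\<close>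

lemma translate_coset_partition:
  assumes "K \<subseteq> carrier G" "r \<in> carrier G" "g \<in> carrier G"
  shows "translate G g (coset_partition G H K r) =
    (\<lambda>x. x <# (K \<union> (K #> r))) ` (if g \<in> H then H else carrier G - H)"
proof -
  have "K \<union> (K #> r) \<subseteq> carrier G"
    using assms r_coset_subset_G by simp
  then have "translate G g (coset_partition G H K r) =
      (\<lambda>x. x <# (K \<union> (K #> r))) ` ((\<lambda>h. g \<otimes> h) ` H)"
    using assms(3) by (auto simp: translate_def coset_partition_image image_image lcos_m_assoc)
  then show ?thesis by (simp only: mult_image(1)[OF assms(3)])
qed

lemma translate_coset_partition_inside:
  assumes "K \<subseteq> carrier G" "r \<in> carrier G" "g \<in> H"
  shows "translate G g (coset_partition G H K r) = coset_partition G H K r"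
  using assms by (simp add: translate_coset_partition) (simp add: coset_partition_image)

lemma translate_coset_partition_outside:
  assumes "K \<subseteq> carrier G" "r \<in> carrier G - H" "g \<in> carrier G - H"
  shows "translate G g (coset_partition G H K r) =
    coset_partition G H (conj_subgroup G K (inv r)) (inv r)"
proof -
  let ?B = "K \<union> (K #> r)"
  have B: "?B \<subseteq> carrier G"
    using assms r_coset_subset_G by simp
  have "inv r <# ?B = (inv r <# K) \<union> (inv r <# (K #> r))"
    by (auto simp: l_coset_def)
  \<comment> \<open>Multiplying a block by \<open>inv r\<close> exchanges its halves:
    \<open>Kr\<close> becomes the conjugate \<open>K'\<close> of \<open>K\<close>, and
    \<open>K\<close> becomes the coset of \<open>K'\<close> by \<open>inv r\<close>.\<close>
  moreover have "inv r <# (K #> r) = conj_subgroup G K (inv r)"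
    using assms by (simp add: conj_subgroup_def coset_assoc)
  moreover have "inv r <# K = conj_subgroup G K (inv r) #> inv r"
    using assms by (simp add: conj_subgroup_def coset_mult_assoc l_coset_subset_G)
  ultimately have *: "conj_subgroup G K (inv r) \<union> (conj_subgroup G K (inv r) #> inv r) = (inv r <# ?B)"
    by auto
  \<comment> \<open>The complement of \<open>H\<close> is \<open>H #> inv r\<close>, so the blocks
    can again be indexed by \<open>H\<close> once \<open>inv r\<close> is absorbed into the base
    block.\<close>
  have "(\<lambda>x. x <# ?B) ` (carrier G - H) = (\<lambda>x. x <# ?B) ` ((\<lambda>h. h \<otimes> inv r) ` H)"
    using assms by (simp add: mult_image inv_mem_iff)
  also have "\<dots> = (\<lambda>h. h <# (inv r <# ?B)) ` H"
    using B assms by (auto simp: image_image lcos_m_assoc)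
  finally show ?thesis
    using assms by (simp add: translate_coset_partition) (simp add: coset_partition_image *)
qed

section \<open>Blocks, their two halves, and the partition property\<close>

lemma block_inter:
  assumes "K \<subseteq> H" "r \<in> carrier G - H" "h \<in> H"
  shows "(h <# (K \<union> (K #> r))) \<inter> H = h <# K"
    and "(h <# (K \<union> (K #> r))) - H = h <# (K #> r)"
  \<comment> \<open>By parity, for \<open>h\<close> in \<open>H\<close> the half \<open>hK\<close>
    lies inside \<open>H\<close> and the half \<open>hKr\<close> outside.\<close>
  using assms by (auto simp: l_coset_def r_coset_def mult_mem_iff subsetD)

text \<open>Since \<open>kK = K\<close>, a block depends on its multiplier \<open>h\<close> only
  through the coset \<open>hK\<close>.\<close>

lemma block_absorb:
  assumes "subgroup K G" "r \<in> carrier G" "k \<in> K"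
  shows "k <# (K \<union> (K #> r)) = K \<union> (K #> r)" and "k <# (K #> r) = K #> r"
proof -
  have k: "k \<in> carrier G" "K \<subseteq> carrier G" "k <# K = K"
    using assms subgroup.subset[OF assms(1)] coset_join3[of k K] by auto
  then show *: "k <# (K #> r) = K #> r"
    using assms by (simp add: coset_assoc)
  have "k <# (K \<union> (K #> r)) = (k <# K) \<union> (k <# (K #> r))"
    by (auto simp: l_coset_def)
  then show "k <# (K \<union> (K #> r)) = K \<union> (K #> r)"
    using k * by simp
qed

text \<open>The block containing \<open>\<one>\<close> is \<open>K \<union> Kr\<close>, and
  intersecting it with \<open>H\<close> and with the complement separates \<open>K\<close> from
  \<open>Kr\<close>. Both can thus be read off the partition.\<close>

lemma coset_partition_inject:
  assumes K: "subgroup K G" "K \<subseteq> H" "r \<in> carrier G - H"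
    and K': "subgroup K' G" "K' \<subseteq> H" "r' \<in> carrier G - H"
    and eq: "coset_partition G H K r = coset_partition G H K' r'"
  shows "K = K'" and "K #> r = K' #> r'"
proof -
  have one: "\<one> \<in> K" "\<one> \<in> K'" using K K' subgroup.one_closed by auto
  have "K \<union> (K #> r) = \<one> <# (K \<union> (K #> r))"
    using K r_coset_subset_G[of K r] subset by (simp add: lcos_mult_one)
  then have "K \<union> (K #> r) \<in> coset_partition G H K' r'"
    unfolding eq[symmetric] unfolding coset_partition_image using one_closed by (rule image_eqI)
  then obtain h where h: "h \<in> H" "K \<union> (K #> r) = h <# (K' \<union> (K' #> r'))"
    unfolding coset_partition_image by blast
  have "K = (K \<union> (K #> r)) \<inter> H" "K #> r = (K \<union> (K #> r)) - H"
    using K by (auto simp: r_coset_def mult_mem_iff subsetD)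
  then have KK: "K = h <# K'" "K #> r = h <# (K' #> r')"
    using block_inter K' h by auto
  \<comment> \<open>The identity lies in \<open>K = hK'\<close>, which forces \<open>h\<close> to be
    the inverse of an element of \<open>K'\<close>; the block on the right is then the one with
    trivial multiplier.\<close>
  then obtain k where "k \<in> K'" "\<one> = h \<otimes> k"
    using one(1) by (auto simp: l_coset_def)
  then have "inv k = h"
    using h(1) K'(2) by (intro inv_equality) auto
  then have "h \<in> K'"
    using subgroup.m_inv_closed[OF K'(1) \<open>k \<in> K'\<close>] by simp
  then have "h <# K' = K'" "h <# (K' #> r') = K' #> r'"
    using K' h(1) block_absorb(2) coset_join3 by auto
  then show "K = K'" "K #> r = K' #> r'"
    using KK by (simp_all only:)
qed

text \<open>The blocks cover the group because they contain \<open>H\<one>\<close> and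
  \<open>Hr\<close>. If two of them meet, they meet in halves of the same kind, so \<open>aK\<close>
  and \<open>bK\<close> meet, and absorption makes the blocks equal.\<close>

lemma partition_on_coset_partition:
  assumes K: "subgroup K G" "K \<subseteq> H" "r \<in> carrier G - H"
  shows "partition_on (carrier G) (coset_partition G H K r)"
proof (rule partition_onI)
  let ?B = "K \<union> (K #> r)"
  have one: "\<one> \<in> K" using K subgroup.one_closed by auto
  have B: "?B \<subseteq> carrier G"
    using K r_coset_subset_G[of K r] subset by auto
  have "\<one> \<in> ?B" "r \<in> ?B" using one K by (force simp: r_coset_def)+
  show "\<Union>(coset_partition G H K r) = carrier G"
  proof
    show "\<Union>(coset_partition G H K r) \<subseteq> carrier G"
      using B by (auto simp: coset_partition_image l_coset_def)
    have "x \<in> \<Union>(coset_partition G H K r)" if "x \<in> carrier G" for x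
    proof -
      have "x \<in> (\<lambda>h. h \<otimes> \<one>) ` H \<union> (\<lambda>h. h \<otimes> r) ` H"
        using that K mult_image(2)[of r] mult_image(2)[of \<one>] by auto
      then obtain h b where "h \<in> H" "b \<in> ?B" "x = h \<otimes> b"
        using \<open>\<one> \<in> ?B\<close> \<open>r \<in> ?B\<close> by blast
      then show ?thesis by (auto simp: coset_partition_image l_coset_def)
    qed
    then show "carrier G \<subseteq> \<Union>(coset_partition G H K r)" by blast
  qed
  show "{} \<notin> coset_partition G H K r"
    using one by (auto simp: coset_partition_image l_coset_def)
next
  let ?B = "K \<union> (K #> r)"
  fix p q assume "p \<in> coset_partition G H K r" "q \<in> coset_partition G H K r" "p \<noteq> q"
  then obtain a b where ab: "a \<in> H" "b \<in> H" "p = (a <# ?B)" "q = (b <# ?B)"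
    by (auto simp: coset_partition_image)
  have B: "?B \<subseteq> carrier G"
    using K r_coset_subset_G[of K r] subset by auto
  show "disjnt p q"
  proof (rule ccontr)
    assume "\<not> disjnt p q"
    then obtain x where x: "x \<in> a <# ?B" "x \<in> b <# ?B" using ab by (auto simp: disjnt_def)
    have c: "a \<in> carrier G" "b \<in> carrier G" "r \<in> carrier G" "K \<subseteq> carrier G"
      using ab K subset by auto
    \<comment> \<open>A common point inside \<open>H\<close> lies in \<open>aK\<close> and
      \<open>bK\<close>; one outside lies in \<open>aKr\<close> and \<open>bKr\<close>, where
      \<open>r\<close> is cancelled on the right.\<close>
    obtain y z where yz: "y \<in> K" "z \<in> K" "a \<otimes> y = b \<otimes> z"
    proof (cases "x \<in> H")
      case True
      then have "x \<in> a <# K" "x \<in> b <# K"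
        using x block_inter(1)[OF K(2,3)] ab by blast+
      then obtain y z where "y \<in> K" "z \<in> K" "x = a \<otimes> y" "x = b \<otimes> z"
        by (auto simp: l_coset_def)
      then show ?thesis using that by simp
    next
      case False
      then have "x \<in> a <# (K #> r)" "x \<in> b <# (K #> r)"
        using x block_inter(2)[OF K(2,3)] ab by blast+
      then obtain y z where yz: "y \<in> K" "z \<in> K" "x = a \<otimes> (y \<otimes> r)" "x = b \<otimes> (z \<otimes> r)"
        by (auto simp: l_coset_def r_coset_def)
      moreover have yz': "y \<in> carrier G" "z \<in> carrier G" using yz c by auto
      ultimately have "(a \<otimes> y) \<otimes> r = (b \<otimes> z) \<otimes> r"
        using c by (simp add: m_assoc)
      then have "a \<otimes> y = b \<otimes> z" using yz' c by simp
      then show ?thesis using that yz(1,2) by blast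
    qed
    have yz': "y \<in> carrier G" "z \<in> carrier G" using yz c by auto
    have "a <# ?B = a <# (y <# ?B)"
      using block_absorb(1)[OF K(1) c(3) yz(1)] by simp
    also have "\<dots> = b <# (z <# ?B)"
      using lcos_m_assoc[OF B c(1) yz'(1)] lcos_m_assoc[OF B c(2) yz'(2)] yz(3) by simp
    also have "\<dots> = b <# ?B"
      using block_absorb(1)[OF K(1) c(3) yz(2)] by simp
    finally have "p = q" using ab by simp
    then show False using \<open>p \<noteq> q\<close> by simp
  qed
qed

section \<open>Stabilizers, semiperfection and equivalence\<close>

lemma stabilizer_coset_partition:
  assumes K: "K \<subseteq> carrier G" "r \<in> carrier G - H"
  defines "P \<equiv> coset_partition G H K r"
  shows "partition_stabilizer G P =
    (if translate G (inv r) P = P then carrier G else H)"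
proof -
  have r: "inv r \<in> carrier G - H" using K inv_mem_iff by auto
  \<comment> \<open>\<open>inv r\<close> stands for all elements outside \<open>H\<close>, which
    have the same effect on \<open>P\<close>.\<close>
  have *: "translate G g P = (if g \<in> H then P else translate G (inv r) P)" if "g \<in> carrier G" for g
    using that K r translate_coset_partition_outside[OF K] translate_coset_partition_inside[of K r g]
    unfolding P_def by simp
  have "g \<in> partition_stabilizer G P \<longleftrightarrow> g \<in> carrier G \<and> (g \<in> H \<or> translate G (inv r) P = P)" for g
    using *[of g]
    by (cases "g \<in> H")
      (auto simp only: partition_stabilizer_def stabilizer_def mem_Collect_eq if_True if_False)
  then show ?thesis
    using subset by auto
qed

text \<open>The stabilizer is either the whole group, of index 1, or \<open>H\<close>, of index 2.
  This reconciles the definition by index with the descriptions "not all of \<open>G\<close>" and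
  "equal to \<open>H\<close>".\<close>

lemma semiperfect_coset_partition:
  assumes K: "K \<subseteq> carrier G" "r \<in> carrier G - H"
  defines "P \<equiv> coset_partition G H K r"
  shows "semiperfect G P \<longleftrightarrow> translate G (inv r) P \<noteq> P"
    and "semiperfect G P \<longleftrightarrow> partition_stabilizer G P \<noteq> carrier G"
    and "semiperfect G P \<longleftrightarrow> partition_stabilizer G P = H"
proof -
  have "rcosets (carrier G) = {carrier G}"
    using coset_join2[of _ "carrier G"] subgroup_self by (auto simp: RCOSETS_def)
  then have one: "subgroup_index G (carrier G) = 1" by (simp add: subgroup_index_def)
  have "H \<noteq> carrier G" using K by auto
  then show "semiperfect G P \<longleftrightarrow> translate G (inv r) P \<noteq> P"
    "semiperfect G P \<longleftrightarrow> partition_stabilizer G P \<noteq> carrier G"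
    "semiperfect G P \<longleftrightarrow> partition_stabilizer G P = H"
    using one index_two stabilizer_coset_partition[OF K]
    unfolding semiperfect_def P_def by auto
qed

lemma equivalent_coset_partition_iff:
  assumes K: "K \<subseteq> carrier G" "r \<in> carrier G - H"
  shows "equivalent_partitions G (coset_partition G H K r) Q \<longleftrightarrow>
    Q = coset_partition G H K r \<or> Q = coset_partition G H (conj_subgroup G K (inv r)) (inv r)"
proof -
  have r: "inv r \<in> carrier G - H" using K inv_mem_iff by auto
  have "translate G g (coset_partition G H K r) = (if g \<in> H then coset_partition G H K r
      else coset_partition G H (conj_subgroup G K (inv r)) (inv r))" if "g \<in> carrier G" for g
    using that K translate_coset_partition_outside[OF K, of g]
      translate_coset_partition_inside[of K r g] by simp
  then have "equivalent_partitions G (coset_partition G H K r) Q \<longleftrightarrow>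
      (\<exists>g\<in>carrier G. Q = (if g \<in> H then coset_partition G H K r
        else coset_partition G H (conj_subgroup G K (inv r)) (inv r)))"
    unfolding equivalent_partitions_def by simp
  also have "\<dots> \<longleftrightarrow> Q = coset_partition G H K r \<or>
      Q = coset_partition G H (conj_subgroup G K (inv r)) (inv r)"
    \<comment> \<open>Both values are attained: the first at \<open>\<one>\<close>, the second at
      \<open>inv r\<close>.\<close>
    using r one_closed mem_carrier by (metis DiffE)
  finally show ?thesis .
qed

text \<open>\<open>H\<close> is normal, having index two, so conjugation by any element of the whole
  group stays inside it.\<close>

lemma conj_subgroup_subset:
  assumes "J \<subseteq> H" "a \<in> carrier G"
  shows "conj_subgroup G J a \<subseteq> H"
  using assms by (auto simp: conj_subgroup_def l_coset_def r_coset_def mult_mem_iff inv_mem_iff subsetD)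

end

section \<open>The family of partitions indexed by \<open>L\<close> and \<open>R\<close>\<close>

theorem theorem4:
  fixes G :: "('a, 'b) monoid_scheme"
    and H J L :: "'a set"
    and R :: "'a \<Rightarrow> 'a set"
  assumes "group G"
    and "subgroup H G"
    and "subgroup_index G H = 2"
    and "subgroup J G" and "J \<subseteq> H"
    and "complete_reps
           (lcosets\<^bsub>G\<lparr>carrier := H\<rparr>\<^esub> (normalizer (G\<lparr>carrier := H\<rparr>) J)) L"
    and "\<And>l. l \<in> L \<Longrightarrow>
           complete_reps
             {C \<in> rcosets\<^bsub>G\<^esub> (conj_subgroup G J l). C \<subseteq> carrier G - H} (R l)"
  shows
    "(\<forall>P \<in> partition_family G H J L R.
        partition_on (carrier G) P \<and>
        (semiperfect G P \<longleftrightarrow> partition_stabilizer G P \<noteq> carrier G) \<and>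
        (semiperfect G P \<longleftrightarrow> partition_stabilizer G P = H)) \<and>
     (normalizer G J = normalizer (G\<lparr>carrier := H\<rparr>) J \<longrightarrow>
        (\<forall>P \<in> partition_family G H J L R. \<forall>Q \<in> partition_family G H J L R.
           semiperfect G P \<and> semiperfect G Q \<and> P \<noteq> Q \<longrightarrow>
           \<not> equivalent_partitions G P Q)) \<and>
     (normalizer G J \<noteq> normalizer (G\<lparr>carrier := H\<rparr>) J \<longrightarrow>
        (\<forall>P \<in> partition_family G H J L R. semiperfect G P \<longrightarrow>
           (\<exists>!Q. Q \<in> partition_family G H J L R \<and> Q \<noteq> P \<and> equivalent_partitions G P Q) \<and>
           (\<forall>Q \<in> partition_family G H J L R.
              Q \<noteq> P \<and> equivalent_partitions G P Q \<longrightarrow> semiperfect G Q)))"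
proof -
  interpret group G by fact
  interpret index_two_subgroup G H
    using assms by (simp add: index_two_subgroup_def index_two_subgroup_axioms_def)
  let ?N = "normalizer (G\<lparr>carrier := H\<rparr>) J"
  let ?F = "partition_family G H J L R"
  define K where "K = conj_subgroup G J"
  \<comment> \<open>The first index ranges over more than \<open>L\<close>: the other orbit member
    of \<open>P l r\<close> has first index \<open>inv r \<otimes> l\<close>, which lies outside
    \<open>H\<close>.\<close>
  define P where "P l = coset_partition G H (K l)" for l
  have J: "J \<subseteq> carrier G" using assms subset by auto
  have N: "?N = normalizer G J \<inter> H"
    using normalizer_in_subgroup[OF subgroup_axioms \<open>J \<subseteq> H\<close>] .
  interpret S: group "G\<lparr>carrier := H\<rparr>"
    using subgroup_imp_group subgroup_axioms by blast
  have subN: "subgroup ?N (G\<lparr>carrier := H\<rparr>)"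
    using S.normalizer_imp_subgroup \<open>J \<subseteq> H\<close> by simp
  have L: "l \<in> H" if "l \<in> L" for l
    using that assms(6) S.lcosets_part_G[OF subN] by (auto simp: complete_reps_def)
  have R: "r \<in> carrier G - H" if "l \<in> L" "r \<in> R l" for l r
    using that assms(7)[OF that(1)] by (auto simp: complete_reps_def)
  have K: "subgroup (K l) G" "K l \<subseteq> H" "K l \<subseteq> carrier G" if "l \<in> carrier G" for l
    using that assms subgroup_conj_subgroup conj_subgroup_subset subset unfolding K_def by blast+
  have F: "?F = {P l r | l r. l \<in> L \<and> r \<in> R l}"
    by (simp add: partition_family_def P_def K_def)
  have equiv: "equivalent_partitions G (P l r) Q \<longleftrightarrow>
      Q = P l r \<or> Q = P (inv\<^bsub>G\<^esub> r \<otimes>\<^bsub>G\<^esub> l) (inv\<^bsub>G\<^esub> r)" if "l \<in> L" "r \<in> R l" for l r Q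
    using equivalent_coset_partition_iff[of "K l" r Q] K(3)[of l] L[OF that(1)] R[OF that] J
    by (simp add: P_def K_def conj_subgroup_mult)
  \<comment> \<open>The right side says that the orbit of \<open>P l r\<close> really has two
    members.\<close>
  have semi: "semiperfect G (P l r) \<longleftrightarrow> P (inv\<^bsub>G\<^esub> r \<otimes>\<^bsub>G\<^esub> l) (inv\<^bsub>G\<^esub> r) \<noteq> P l r"
    if "l \<in> L" "r \<in> R l" for l r
    using semiperfect_coset_partition(1)[of "K l" r] translate_coset_partition_outside[of "K l" r "inv\<^bsub>G\<^esub> r"]
      K(3)[of l] L[OF that(1)] R[OF that] J
    by (simp add: P_def K_def conj_subgroup_mult inv_mem_iff)

  have basic: "partition_on (carrier G) Q \<and>
        (semiperfect G Q \<longleftrightarrow> partition_stabilizer G Q \<noteq> carrier G) \<and>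
        (semiperfect G Q \<longleftrightarrow> partition_stabilizer G Q = H)" if "Q \<in> ?F" for Q
  proof -
    obtain l r where lr: "l \<in> L" "r \<in> R l" and Q: "Q = P l r"
      using \<open>Q \<in> ?F\<close> unfolding F by blast
    note K = K[OF mem_carrier[OF L[OF lr(1)]]]
    show ?thesis
      unfolding Q P_def using partition_on_coset_partition[OF K(1,2) R[OF lr]]
        semiperfect_coset_partition(2,3)[OF K(3) R[OF lr]] by simp
  qed

  have unrelated: "\<not> equivalent_partitions G Q Q'"
    if "normalizer G J = ?N" "Q \<in> ?F" "Q' \<in> ?F" "Q \<noteq> Q'" for Q Q'
  proof
    assume eq: "equivalent_partitions G Q Q'"
    obtain l r where lr: "l \<in> L" "r \<in> R l" "Q = P l r" using \<open>Q \<in> ?F\<close> unfolding F by blast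
    obtain m s where ms: "m \<in> L" "s \<in> R m" "Q' = P m s" using \<open>Q' \<in> ?F\<close> unfolding F by blast
    note c = L[OF lr(1)] L[OF ms(1)] R[OF lr(1,2)] R[OF ms(1,2)]
    have "P m s = P (inv\<^bsub>G\<^esub> r \<otimes>\<^bsub>G\<^esub> l) (inv\<^bsub>G\<^esub> r)"
      using eq equiv lr ms \<open>Q \<noteq> Q'\<close> by metis
    then have "K m = K (inv\<^bsub>G\<^esub> r \<otimes>\<^bsub>G\<^esub> l)"
      unfolding P_def
      by (rule coset_partition_inject(1)[rotated 6]) (use c K inv_mem_iff in auto)
    then have "inv\<^bsub>G\<^esub> m \<otimes>\<^bsub>G\<^esub> (inv\<^bsub>G\<^esub> r \<otimes>\<^bsub>G\<^esub> l) \<in> normalizer G J"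
      using conj_subgroup_eq_iff[OF J] c unfolding K_def by simp
    \<comment> \<open>Of the three factors only \<open>inv r\<close> lies outside \<open>H\<close>,
      so the product does too, whereas the normalizer of \<open>J\<close> is contained in
      \<open>H\<close> here.\<close>
    moreover have "inv\<^bsub>G\<^esub> m \<otimes>\<^bsub>G\<^esub> (inv\<^bsub>G\<^esub> r \<otimes>\<^bsub>G\<^esub> l) \<notin> H"
      using c by (simp add: mult_mem_iff inv_mem_iff)
    ultimately show False using that(1) N by blast
  qed

  have partner: "P (inv\<^bsub>G\<^esub> r \<otimes>\<^bsub>G\<^esub> l) (inv\<^bsub>G\<^esub> r) \<in> ?F"
    if "normalizer G J \<noteq> ?N" "l \<in> L" "r \<in> R l" for l r
  proof -
    note c = L[OF that(2)] R[OF that(2,3)]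
    obtain n where n: "n \<in> normalizer G J" "n \<in> carrier G - H"
      using \<open>normalizer G J \<noteq> ?N\<close> unfolding N using normalizer_eq[OF J] by blast
    \<comment> \<open>Multiplying by \<open>n\<close> on the right moves
      \<open>inv r \<otimes> l\<close> into \<open>H\<close> and leaves the conjugate of
      \<open>J\<close> unchanged, as \<open>n\<close> normalizes \<open>J\<close>.\<close>
    define a where "a = inv\<^bsub>G\<^esub> r \<otimes>\<^bsub>G\<^esub> l \<otimes>\<^bsub>G\<^esub> n"
    have a: "a \<in> H" using c n by (simp add: a_def mult_mem_iff inv_mem_iff)
    have "inv\<^bsub>G\<^esub> (inv\<^bsub>G\<^esub> r \<otimes>\<^bsub>G\<^esub> l) \<otimes>\<^bsub>G\<^esub> a = n"
      using c n inv_solve_left'[of n "inv\<^bsub>G\<^esub> r \<otimes>\<^bsub>G\<^esub> l" a] a by (simp add: a_def)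
    then have Ka: "K (inv\<^bsub>G\<^esub> r \<otimes>\<^bsub>G\<^esub> l) = K a"
      unfolding K_def using conj_subgroup_eq_iff[OF J, of "inv\<^bsub>G\<^esub> r \<otimes>\<^bsub>G\<^esub> l" a] c n a by simp
    \<comment> \<open>The representative \<open>m\<close> in \<open>L\<close> of the coset of
      \<open>a\<close> defines the same conjugate of \<open>J\<close>.\<close>
    have "a <#\<^bsub>G\<^esub> ?N \<in> lcosets\<^bsub>G\<lparr>carrier := H\<rparr>\<^esub> ?N"
      using a by (auto simp: LCOSETS_def)
    then obtain m where m: "m \<in> L" "m \<in> a <#\<^bsub>G\<^esub> ?N"
      using complete_reps_exists[OF assms(6)] by blast
    have "inv\<^bsub>G\<^esub> a \<otimes>\<^bsub>G\<^esub> m \<in> normalizer G J"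
      using m(2) a mem_carrier unfolding N by (auto simp: l_coset_def m_assoc[symmetric])
    then have Km: "K a = K m"
      unfolding K_def using conj_subgroup_eq_iff[OF J, of a m] a L[OF m(1)] by simp
    have r': "inv\<^bsub>G\<^esub> r \<in> carrier G - H" using c by (simp add: inv_mem_iff)
    \<comment> \<open>The second index is handled likewise: the partition depends on it only through
      its right coset of \<open>K m\<close>, so \<open>inv r\<close> may be replaced by the
      representative \<open>s\<close> in \<open>R m\<close>.\<close>
    have Kr: "K m #>\<^bsub>G\<^esub> inv\<^bsub>G\<^esub> r \<in> rcosets\<^bsub>G\<^esub> (K m)"
      using r' L[OF m(1)] K(3) by (auto simp: RCOSETS_def)
    moreover have "K m #>\<^bsub>G\<^esub> inv\<^bsub>G\<^esub> r \<subseteq> carrier G - H"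
      using r' K(2)[of m] L[OF m(1)] by (auto simp: r_coset_def mult_mem_iff subsetD)
    ultimately obtain s where s: "s \<in> R m" "s \<in> K m #>\<^bsub>G\<^esub> inv\<^bsub>G\<^esub> r"
      using complete_reps_exists[OF assms(7)[OF m(1)], of "K m #>\<^bsub>G\<^esub> inv\<^bsub>G\<^esub> r"] unfolding K_def by blast
    have "K m #>\<^bsub>G\<^esub> inv\<^bsub>G\<^esub> r = K m #>\<^bsub>G\<^esub> s"
      using s(2) r' K(1)[of m] L[OF m(1)] by (intro repr_independence) auto
    then have "P (inv\<^bsub>G\<^esub> r \<otimes>\<^bsub>G\<^esub> l) (inv\<^bsub>G\<^esub> r) = P m s"
      unfolding P_def coset_partition_def Ka Km by simp
    then show ?thesis unfolding F using m(1) s(1) by blast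
  qed

  have paired: "(\<exists>!Q'. Q' \<in> ?F \<and> Q' \<noteq> Q \<and> equivalent_partitions G Q Q') \<and>
      (\<forall>Q' \<in> ?F. Q' \<noteq> Q \<and> equivalent_partitions G Q Q' \<longrightarrow> semiperfect G Q')"
    if "normalizer G J \<noteq> ?N" "Q \<in> ?F" "semiperfect G Q" for Q
  proof -
    obtain l r where lr: "l \<in> L" "r \<in> R l" "Q = P l r" using \<open>Q \<in> ?F\<close> unfolding F by blast
    let ?Q = "P (inv\<^bsub>G\<^esub> r \<otimes>\<^bsub>G\<^esub> l) (inv\<^bsub>G\<^esub> r)"
    have iff: "equivalent_partitions G Q Q' \<longleftrightarrow> Q' = Q \<or> Q' = ?Q" for Q'
      using equiv lr by simp
    have "?Q \<noteq> Q" using semi lr that(3) by simp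
    moreover have "?Q \<in> ?F" using partner that lr by simp
    \<comment> \<open>Passing to the other orbit member twice returns to \<open>Q\<close>. Since
      \<open>?Q\<close> is some \<open>P m s\<close> of the family and \<open>Q\<close> differs from
      it, \<open>Q\<close> is the second member of its orbit, and \<open>semi\<close> applies to
      \<open>P m s\<close>.\<close>
    moreover have sQ: "semiperfect G ?Q"
    proof -
      obtain m s where ms: "m \<in> L" "s \<in> R m" "?Q = P m s" using \<open>?Q \<in> ?F\<close> unfolding F by blast
      note c = L[OF lr(1)] R[OF lr(1,2)]
      have "inv\<^bsub>G\<^esub> r \<in> carrier G - H" using c by (simp add: inv_mem_iff)
      then have "equivalent_partitions G ?Q (P (inv\<^bsub>G\<^esub> (inv\<^bsub>G\<^esub> r) \<otimes>\<^bsub>G\<^esub> (inv\<^bsub>G\<^esub> r \<otimes>\<^bsub>G\<^esub> l)) (inv\<^bsub>G\<^esub> (inv\<^bsub>G\<^esub> r)))"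
        using equivalent_coset_partition_iff[of "K (inv\<^bsub>G\<^esub> r \<otimes>\<^bsub>G\<^esub> l)" "inv\<^bsub>G\<^esub> r"] K(3)[of "inv\<^bsub>G\<^esub> r \<otimes>\<^bsub>G\<^esub> l"] c J
        by (simp add: P_def K_def conj_subgroup_mult)
      moreover have "inv\<^bsub>G\<^esub> (inv\<^bsub>G\<^esub> r) \<otimes>\<^bsub>G\<^esub> (inv\<^bsub>G\<^esub> r \<otimes>\<^bsub>G\<^esub> l) = l" "inv\<^bsub>G\<^esub> (inv\<^bsub>G\<^esub> r) = r"
        using c by (simp_all add: m_assoc[symmetric])
      ultimately have "equivalent_partitions G ?Q Q" using lr by simp
      then have "Q = P (inv\<^bsub>G\<^esub> s \<otimes>\<^bsub>G\<^esub> m) (inv\<^bsub>G\<^esub> s)"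
        using equiv[OF ms(1,2)] \<open>?Q \<noteq> Q\<close> unfolding ms(3) by simp
      then show ?thesis
        using semi[OF ms(1,2)] \<open>?Q \<noteq> Q\<close> unfolding ms(3) by simp
    qed
    ultimately have Q': "?Q \<in> ?F" "?Q \<noteq> Q" "equivalent_partitions G Q ?Q"
      by (simp_all add: iff)
    \<comment> \<open>The orbit of \<open>Q\<close> consists of \<open>Q\<close> and
      \<open>?Q\<close> only.\<close>
    have unique: "Q' = ?Q" if "Q' \<noteq> Q" "equivalent_partitions G Q Q'" for Q'
      using that(2) unfolding iff by (rule disjE) (use that(1) in simp_all)
    show ?thesis
    proof (intro conjI ballI impI; (elim conjE)?)
      show "\<exists>!Q'. Q' \<in> ?F \<and> Q' \<noteq> Q \<and> equivalent_partitions G Q Q'"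
      proof (rule ex1I)
        show "?Q \<in> ?F \<and> ?Q \<noteq> Q \<and> equivalent_partitions G Q ?Q"
          using Q' by (intro conjI)
      qed (elim conjE, rule unique)
    next
      fix Q' assume "Q' \<noteq> Q" "equivalent_partitions G Q Q'"
      then show "semiperfect G Q'" using sQ unique by simp
    qed
  qed

  show ?thesis
  proof (intro conjI)
    show "\<forall>Q \<in> ?F. partition_on (carrier G) Q \<and>
        (semiperfect G Q \<longleftrightarrow> partition_stabilizer G Q \<noteq> carrier G) \<and>
        (semiperfect G Q \<longleftrightarrow> partition_stabilizer G Q = H)"
      by (intro ballI basic)
    show "normalizer G J = ?N \<longrightarrow> (\<forall>Q \<in> ?F. \<forall>Q' \<in> ?F.
        semiperfect G Q \<and> semiperfect G Q' \<and> Q \<noteq> Q' \<longrightarrow> \<not> equivalent_partitions G Q Q')"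
      by (intro impI ballI unrelated; elim conjE)
    show "normalizer G J \<noteq> ?N \<longrightarrow> (\<forall>Q \<in> ?F. semiperfect G Q \<longrightarrow>
        (\<exists>!Q'. Q' \<in> ?F \<and> Q' \<noteq> Q \<and> equivalent_partitions G Q Q') \<and>
        (\<forall>Q' \<in> ?F. Q' \<noteq> Q \<and> equivalent_partitions G Q Q' \<longrightarrow> semiperfect G Q'))"
      by (intro impI ballI paired)
  qed
qed

end
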